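(* Let $0<p<1$, $n\ge1$, and consider the birth-death chain $K$ on $\{0,1,\dots,n\}$ with transition probabilities $$K(x,x-1)=\frac{x}{n}(1-p),\quad K(x,x)=\frac{x}{n}p+\left(1-\frac{x}{n}\right)(1-p),\quad K(x,x+1)=p\left(1-\frac{x}{n}\right),$$ whose stationary distribution is the $p$-binomial distribution $\pi(x)=\binom nx p^x(1-p)^{n-x}$. Let $s^*(r)=s^*_n(r)$ be its maximal separation distance, and let $r$ be a non-negative integer. (1) $s^*(r)=\mathbb{P}(X>r)$, where $X$ is the sum of independent geometric random variables with parameters $\frac in$ for $1\le i\le n$. (2) $s^*(r)=1-\frac{n!\,S(r,n)}{n^r}$, where $S(r,k)$ is a Stirling number of the second kind (i.e. the number of partitions of an $r$-set into $k$ blocks). (3) For $c$ fixed in $\mathbb{R}$ and $n\to\infty$, $$s^*_n(\lfloor n\log(n)+cn\rfloor)=1-e^{-e^{-c}}+O\left(\frac{\log(n)}{n}\right).$$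
   Context: The maximal separation distance is $s^*(r)=\max_{x,y}\left[1-\frac{K^r(x,y)}{\pi(y)}\right]$. A geometric random variable $X$ with parameter $p\in(0,1]$ satisfies $\mathbb{P}(X=m)=p(1-p)^{m-1}$ for $m\ge1$. The implied constant in (3) may depend on $c$. (In the paper this chain is written $UD_n$, where $U_n(x,n)=(1-p)\cdot(x,n+1)+p\cdot(x+1,n+1)$ and $D_n(x,n)=(1-\frac xn)\cdot(x,n-1)+\frac xn\cdot(x-1,n-1)$ on formal linear combinations of pairs $(x,n)$, $0\le x\le n$, and $UD_n=U_{n-1}D_n$.) *)

theory Defs
  imports
    "HOL-Probability.Probability"
    "HOL-Combinatorics.Stirling"
    "HOL-Library.Landau_Symbols"
    "Jordan_Normal_Form.Matrix"
begin

definition bd_chain :: "nat \<Rightarrow> real \<Rightarrow> real mat" where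
  "bd_chain n p = mat (n + 1) (n + 1) (\<lambda>(x, y).
     if x = y + 1 then real x / real n * (1 - p)
     else if y = x then real x / real n * p + (1 - real x / real n) * (1 - p)
     else if y = x + 1 then p * (1 - real x / real n)
     else 0)"

text \<open>For a transition matrix \<open>K\<close> on the states \<open>0, \<dots>, dim_row K - 1\<close>, with stationary
  distribution \<open>\<pi>\<close>.\<close>

definition max_separation :: "real mat \<Rightarrow> nat pmf \<Rightarrow> nat \<Rightarrow> real" where
  "max_separation K \<pi> r =
     Max ((\<lambda>(x, y). 1 - (K ^\<^sub>m r) $$ (x, y) / pmf \<pi> y) ` ({..<dim_row K} \<times> {..<dim_row K}))"

definition sep_bd :: "nat \<Rightarrow> real \<Rightarrow> nat \<Rightarrow> real" where
  "sep_bd n p r = max_separation (bd_chain n p) (binomial_pmf n p) r"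

text \<open>The library's \<^const>\<open>geometric_pmf\<close> counts failures and so starts at 0; here a geometric
  variable counts trials and starts at 1.\<close>

definition geometric1_pmf :: "real \<Rightarrow> nat pmf" where
  "geometric1_pmf q = map_pmf Suc (geometric_pmf q)"

lemma pmf_geometric1:
  assumes "0 < q" "q \<le> 1" "m \<ge> 1"
  shows "pmf (geometric1_pmf q) m = q * (1 - q) ^ (m - 1)"
proof -
  obtain k where k: "m = Suc k" using assms(3) by (cases m) auto
  have "pmf (map_pmf Suc (geometric_pmf q)) (Suc k) = pmf (geometric_pmf q) k"
    by (rule pmf_map_inj') simp
  then show ?thesis using assms k by (simp add: geometric1_pmf_def)
qed

text \<open>The law of \<open>X\<^sub>1 + \<dots> + X\<^sub>n\<close> for independent geometric \<open>X\<^sub>i\<close> with parameter \<open>i / n\<close>.\<close>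

definition geometric_sum_pmf :: "nat \<Rightarrow> nat pmf" where
  "geometric_sum_pmf n =
     map_pmf (\<lambda>f. \<Sum>i\<in>{1..n}. f i) (Pi_pmf {1..n} 0 (\<lambda>i. geometric1_pmf (real i / real n)))"

lemma bd_chain_nonneg:
  assumes "0 < p" "p < 1" "n \<ge> 1" "x \<le> n" "y \<le> n"
  shows "bd_chain n p $$ (x, y) \<ge> 0"
  using assms by (auto simp: bd_chain_def divide_simps intro!: add_nonneg_nonneg mult_nonneg_nonneg)

lemma bd_chain_detailed_balance:
  assumes "0 < p" "p < 1" "n \<ge> 1" "x \<le> n" "y \<le> n"
  shows "pmf (binomial_pmf n p) x * bd_chain n p $$ (x, y) =
         pmf (binomial_pmf n p) y * bd_chain n p $$ (y, x)"
proof -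
  have step: "pmf (binomial_pmf n p) k * bd_chain n p $$ (k, Suc k) =
      pmf (binomial_pmf n p) (Suc k) * bd_chain n p $$ (Suc k, k)" if "Suc k \<le> n" for k
  proof -
    have "Suc k * (n choose Suc k) = (n - k) * (n choose k)"
      using binomial_absorb_comp[of n k] binomial_absorption[of k n] by simp
    then have "real (Suc k * (n choose Suc k)) = real ((n - k) * (n choose k))" by presburger
    then have c: "real (Suc k) * real (n choose Suc k) = (real n - real k) * real (n choose k)"
      using that by (simp only: of_nat_mult) (simp add: of_nat_diff)
    have e: "n - k = Suc (n - Suc k)" using that by simp
    have "pmf (binomial_pmf n p) k * bd_chain n p $$ (k, Suc k) =
        ((real n - real k) * real (n choose k)) / real n * p ^ Suc k * (1 - p) ^ (n - k)"
      using assms that by (simp add: bd_chain_def field_simps)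
    also have "\<dots> = (real (Suc k) * real (n choose Suc k)) / real n * p ^ Suc k * (1 - p) ^ (n - k)"
      by (simp only: c)
    also have "\<dots> = pmf (binomial_pmf n p) (Suc k) * bd_chain n p $$ (Suc k, k)"
      using assms that unfolding e by (simp add: bd_chain_def)
    finally show ?thesis .
  qed
  consider "x = y" | "x = Suc y" | "y = Suc x" | "x \<noteq> y" "x \<noteq> Suc y" "y \<noteq> Suc x" by blast
  then show ?thesis
  proof cases
    case 4
    then show ?thesis using assms by (simp add: bd_chain_def)
  qed (use step assms in auto)
qed

lemma bd_chain_row_sum:
  assumes "n \<ge> 1" "x \<le> n"
  shows "(\<Sum>y\<le>n. bd_chain n p $$ (x, y)) = 1"
proof -
  have "(\<Sum>y\<le>n. bd_chain n p $$ (x, y)) =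
    (\<Sum>y\<le>n. (if x = y + 1 then real x / real n * (1 - p) else 0)
      + (if y = x then real x / real n * p + (1 - real x / real n) * (1 - p) else 0)
      + (if y = x + 1 then p * (1 - real x / real n) else 0))"
    using assms by (intro sum.cong) (auto simp: bd_chain_def)
  also have "\<dots> = real x / real n * (1 - p)
      + (real x / real n * p + (1 - real x / real n) * (1 - p)) + p * (1 - real x / real n)"
  proof -
    have "(\<Sum>y\<le>n. if x = y + 1 then real x / real n * (1 - p) else 0) = real x / real n * (1 - p)"
      using assms by (cases x) auto
    moreover have "(\<Sum>y\<le>n. if y = x + 1 then p * (1 - real x / real n) else 0) =
        p * (1 - real x / real n)"
      using assms by (cases "x = n") auto
    ultimately show ?thesis using assms by (simp add: sum.distrib)
  qed
  also have "\<dots> = 1" by (simp add: algebra_simps)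
  finally show ?thesis .
qed

lemma binomial_stationary:
  assumes "0 < p" "p < 1" "n \<ge> 1" "y \<le> n"
  shows "(\<Sum>x\<le>n. pmf (binomial_pmf n p) x * bd_chain n p $$ (x, y)) = pmf (binomial_pmf n p) y"
proof -
  have "(\<Sum>x\<le>n. pmf (binomial_pmf n p) x * bd_chain n p $$ (x, y)) =
      (\<Sum>x\<le>n. pmf (binomial_pmf n p) y * bd_chain n p $$ (y, x))"
    using assms by (intro sum.cong refl bd_chain_detailed_balance) auto
  also have "\<dots> = pmf (binomial_pmf n p) y"
    using assms by (simp only: sum_distrib_left[symmetric] bd_chain_row_sum mult_1_right)
  finally show ?thesis .
qed

end

theory Submission
  imports Defs
begin

text \<open>
  One step of the chain resamples a uniformly chosen one of \<open>n\<close> independent \<open>p\<close>-coins. On generating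
  functions, \<open>n\<close> times a step is \<open>f \<mapsto> L \<cdot> E\<^sub>n f\<close> with \<open>L = 1 - p + p s\<close> and
  \<open>E\<^sub>m f = m f + (1 - s) f'\<close>. Since \<open>L E\<^sub>m (L\<^sup>j g) = j L\<^sup>j g + L\<^sup>j\<^sup>+\<^sup>1 E\<^bsub>m-j\<^esub> g\<close>, the powers of this operator
  normal order with Stirling numbers: \<open>(L E\<^sub>n)\<^sup>r = \<Sum>\<^sub>j S(r,j) L\<^sup>j E\<^bsub>n-j+1\<^esub> \<dots> E\<^sub>n\<close>. Applied to \<open>s\<^sup>x\<close>, all
  summands have nonnegative coefficients, and the one for \<open>j = n\<close> is \<open>n! S(r,n) L\<^sup>n\<close>, that is
  \<open>n! S(r,n) \<pi>\<close>. Hence \<open>K\<^sup>r(x,y) \<ge> n! S(r,n) / n\<^sup>r \<pi>(y)\<close>, with equality at \<open>(0,n)\<close> because the other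
  summands then vanish or have degree below \<open>n\<close>.

  The right-hand side is the probability that a coupon collector is done after \<open>r\<close> draws. This gives
  the sum of geometric variables, one stage at a time, through
  \<open>S(r,k+1) = \<Sum>\<^sub>i (k+1)\<^sup>r\<^sup>-\<^sup>1\<^sup>-\<^sup>i S(i,k)\<close>. The asymptotics follow from
  \<open>n! S(r,n) / n\<^sup>r = \<Sum>\<^sub>k (-1)\<^sup>k (n choose k) (1 - k/n)\<^sup>r\<close> by comparing it term by term with the
  exponential series at \<open>- exp (- c)\<close>.
\<close>

(* Without this, smult denotes the scalar multiplication of HOL-Algebra modules. *)
hide_const (open) module.smult

section \<open>Normal ordering of the transition operator\<close>

text \<open>
  The paper's \<open>D\<close> and \<open>U\<close>, with \<open>(x, n)\<close> encoded as the monomial \<open>s\<^sup>x\<close>, act on polynomials in \<open>s\<close>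
  as \<^term>\<open>down n\<close> divided by \<open>n\<close> and as multiplication by \<open>1 - p + p s\<close>. Dropping the division
  makes the commutation rule below free of denominators.
\<close>

definition down :: "real \<Rightarrow> real poly \<Rightarrow> real poly" where
  "down m f = smult m f + [:1, -1:] * pderiv f"

fun downs :: "real \<Rightarrow> nat \<Rightarrow> real poly \<Rightarrow> real poly" where
  "downs m 0 f = f"
| "downs m (Suc j) f = down (m - real j) (downs m j f)"

lemma coeff_down: "coeff (down m f) i = (m - real i) * coeff f i + real (Suc i) * coeff f (Suc i)"
proof -
  have "coeff ([:1, -1:] * pderiv f) i = real (Suc i) * coeff f (Suc i) - real i * coeff f i"
    by (cases i) (simp_all add: coeff_pderiv)
  then show ?thesis by (simp add: down_def algebra_simps)
qed

lemma down_0 [simp]: "down m 0 = 0"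
  by (simp add: down_def)

lemma down_add: "down m (f + g) = down m f + down m g"
  by (simp add: down_def pderiv_add algebra_simps smult_add_right)

lemma down_smult: "down m (smult a f) = smult a (down m f)"
  by (simp add: down_def pderiv_smult smult_add_right mult.commute)

lemma down_sum: "down m (sum f A) = (\<Sum>x\<in>A. down m (f x))"
  by (induction A rule: infinite_finite_induct) (simp_all add: down_add)

lemma smult_sum_right: "smult a (sum f A) = (\<Sum>x\<in>A. smult a (f x))"
  by (induction A rule: infinite_finite_induct) (simp_all add: smult_add_right)

lemma poly_down_1 [simp]: "poly (down m f) 1 = m * poly f 1"
  by (simp add: down_def)

text \<open>Since \<open>(1 - s) * L' = 1 - L\<close>, the derivative of \<open>L ^ j\<close>
  contributes \<open>j * L ^ j - j * L ^ (j + 1)\<close>: the first part is the extra term, the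
  second lowers \<open>m\<close> by \<open>j\<close>.\<close>

lemma down_mult_power:
  fixes p :: real
  defines "L \<equiv> [:1 - p, p:]"
  shows "L * down m (L ^ j * g) = smult (real j) (L ^ j * g) + L ^ Suc j * down (m - real j) g"
proof -
  have L': "[:1, -1:] * pderiv L = 1 - L"
    by (simp add: L_def pderiv_pCons one_pCons)
  have pd: "L * ([:1, -1:] * pderiv (L ^ j)) = smult (real j) (L ^ j * (1 - L))"
  proof (cases j)
    case (Suc i)
    have "L * ([:1, -1:] * pderiv (L ^ j)) = smult (real j) (L ^ j * ([:1, -1:] * pderiv L))"
      unfolding Suc pderiv_power_Suc
      by (simp only: mult_smult_left mult_smult_right power_Suc mult_ac)
    then show ?thesis by (simp only: L')
  qed simp
  have "L * ([:1, -1:] * pderiv (L ^ j * g))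
      = L * ([:1, -1:] * pderiv (L ^ j)) * g + L ^ Suc j * ([:1, -1:] * pderiv g)"
    unfolding pderiv_mult power_Suc by (simp only: distrib_left mult_ac add_ac)
  also have "\<dots> = smult (real j) (L ^ j * g) - smult (real j) (L ^ Suc j * g)
      + L ^ Suc j * ([:1, -1:] * pderiv g)"
    unfolding pd by (simp add: algebra_simps smult_diff_right)
  finally have *: "L * ([:1, -1:] * pderiv (L ^ j * g)) = \<dots>" .
  have "L * down m (L ^ j * g) = smult m (L ^ Suc j * g) + L * ([:1, -1:] * pderiv (L ^ j * g))"
    unfolding down_def by (simp add: distrib_left mult.assoc)
  then show ?thesis
    unfolding * down_def
    by (simp add: distrib_left right_diff_distrib smult_diff_left mult.assoc)
qed

text \<open>By \<open>down_mult_power\<close>, one more application sends summand \<open>j\<close>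
  to \<open>j\<close> times itself plus summand \<open>j + 1\<close>, which is the Stirling
  recurrence.\<close>

lemma up_down_funpow:
  fixes p m :: real
  defines "L \<equiv> [:1 - p, p:]"
  shows "((\<lambda>g. L * down m g) ^^ r) f = (\<Sum>j\<le>r. smult (real (Stirling r j)) (L ^ j * downs m j f))"
proof (induction r)
  case (Suc r)
  let ?G = "\<lambda>j. L ^ j * downs m j f"
  have "((\<lambda>g. L * down m g) ^^ Suc r) f
      = (\<Sum>j\<le>r. smult (real (Stirling r j)) (L * down m (?G j)))"
    by (simp add: Suc down_sum down_smult sum_distrib_left)
  also have "\<dots> = (\<Sum>j\<le>r. smult (real (j * Stirling r j)) (?G j))
      + (\<Sum>j\<le>r. smult (real (Stirling r j)) (?G (Suc j)))"
    unfolding L_def down_mult_power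
    by (simp add: smult_add_right sum.distrib mult.commute)
  also have "(\<Sum>j\<le>r. smult (real (j * Stirling r j)) (?G j))
      = (\<Sum>j\<le>Suc r. smult (real (j * Stirling r j)) (?G j))"
    by simp
  also have "\<dots> = (\<Sum>j\<le>r. smult (real (Suc j * Stirling r (Suc j))) (?G (Suc j)))"
    by (subst sum.atMost_Suc_shift) simp
  also have "\<dots> + (\<Sum>j\<le>r. smult (real (Stirling r j)) (?G (Suc j)))
      = (\<Sum>j\<le>r. smult (real (Stirling (Suc r) (Suc j))) (?G (Suc j)))"
    by (simp only: sum.distrib[symmetric] smult_add_left[symmetric] of_nat_add[symmetric]
        Stirling.simps)
  also have "\<dots> = (\<Sum>j\<le>Suc r. smult (real (Stirling (Suc r) j)) (?G j))"
    by (subst sum.atMost_Suc_shift) simp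
  finally show ?case .
qed simp

text \<open>Sign and degree bound need each other: the factor \<open>n - j - i\<close> is negative
  only where the coefficients already vanish, and its zero at \<open>i = n - j\<close> lowers the
  degree bound by one.\<close>

lemma coeff_downs:
  assumes "degree f \<le> n" "\<And>i. coeff f i \<ge> 0"
  shows "coeff (downs (real n) j f) i \<ge> 0 \<and> (n < i + j \<longrightarrow> coeff (downs (real n) j f) i = 0)"
proof (induction j arbitrary: i)
  case 0
  then show ?case using assms by (auto simp: coeff_eq_0)
next
  case (Suc j)
  let ?g = "downs (real n) j f"
  have c: "coeff (downs (real n) (Suc j) f) i
      = (real n - real j - real i) * coeff ?g i + real (Suc i) * coeff ?g (Suc i)"
    by (simp add: coeff_down)
  show ?case
  proof (cases "i + j < n")
    case True
    then have "real n - real j - real i \<ge> 0" by linarith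
    then show ?thesis
      using Suc.IH True unfolding c by (auto intro!: add_nonneg_nonneg mult_nonneg_nonneg)
  next
    case False
    have "coeff ?g (Suc i) = 0" using Suc.IH[of "Suc i"] False by auto
    moreover have "real n - real j - real i = 0 \<or> coeff ?g i = 0"
      using Suc.IH[of i] False by (cases "i + j = n") auto
    ultimately show ?thesis unfolding c by auto
  qed
qed

lemma poly_downs_1: "poly (downs m j f) 1 = (\<Prod>i<j. m - real i) * poly f 1"
  by (induction j) (simp_all add: mult_ac)

text \<open>The degree bound leaves a constant, found by evaluating at 1, where the derivative term
  of \<open>down\<close> vanishes.\<close>

lemma downs_full:
  assumes "degree f \<le> n" "\<And>i. coeff f i \<ge> 0"
  shows "downs (real n) n f = [:fact n * poly f 1:]"
proof -
  have "degree (downs (real n) n f) = 0"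
    using coeff_downs[of f n n] assms by (intro le_0_eq[THEN iffD1] degree_le) auto
  then obtain c where c: "downs (real n) n f = [:c:]" by (rule degree_eq_zeroE)
  have "(\<Prod>i<n. real n - real i) = fact n"
    by (simp add: fact_prod_rev of_nat_prod of_nat_diff atLeast0LessThan)
  then have "c = fact n * poly f 1"
    using poly_downs_1[of "real n" n f] unfolding c by simp
  then show ?thesis by (simp add: c)
qed

section \<open>Rows of matrix powers as generating functions\<close>

definition row_poly :: "real mat \<Rightarrow> nat \<Rightarrow> real poly" where
  "row_poly A x = (\<Sum>y<dim_col A. monom (A $$ (x, y)) y)"

lemma coeff_row_poly: "y < dim_col A \<Longrightarrow> coeff (row_poly A x) y = A $$ (x, y)"
  by (simp add: row_poly_def coeff_sum)

lemma row_poly_mult: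
  assumes "x < dim_row A" "dim_col A = dim_row B"
  shows "row_poly (A * B) x = (\<Sum>z<dim_row B. smult (A $$ (x, z)) (row_poly B z))"
proof (rule poly_eqI)
  fix y
  show "coeff (row_poly (A * B) x) y = coeff (\<Sum>z<dim_row B. smult (A $$ (x, z)) (row_poly B z)) y"
  proof (cases "y < dim_col B")
    case True
    then show ?thesis
      using assms by (simp add: coeff_sum coeff_row_poly scalar_prod_def atLeast0LessThan)
  next
    case False
    then show ?thesis by (simp add: row_poly_def coeff_sum)
  qed
qed

lemma row_poly_bd_chain:
  assumes "n \<ge> 1" "z \<le> n"
  shows "smult (real n) (row_poly (bd_chain n p) z) = [:1 - p, p:] * down (real n) (monom 1 z)"
proof (rule poly_eqI)
  fix y
  have c: "coeff ([:1 - p, p:] * g) y = (1 - p) * coeff g y + (if y = 0 then 0 else p * coeff g (y - 1))"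
    for g
    by (cases y) simp_all
  have "coeff (row_poly (bd_chain n p) z) y = (if y \<le> n then bd_chain n p $$ (z, y) else 0)"
    by (simp add: row_poly_def coeff_sum bd_chain_def)
  then show "coeff (smult (real n) (row_poly (bd_chain n p) z)) y
      = coeff ([:1 - p, p:] * down (real n) (monom 1 z)) y"
    unfolding c coeff_down using assms
    by (cases y) (auto simp: bd_chain_def field_simps)
qed

lemma row_poly_bd_chain_power:
  assumes "n \<ge> 1" "x \<le> n"
  shows "smult (real n ^ r) (row_poly (bd_chain n p ^\<^sub>m r) x)
    = ((\<lambda>g. [:1 - p, p:] * down (real n) g) ^^ r) (monom 1 x)"
proof (induction r)
  case 0
  show ?case
    using assms
    by (intro poly_eqI) (auto simp: row_poly_def coeff_sum bd_chain_def)
next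
  case (Suc r)
  let ?K = "bd_chain n p" and ?T = "\<lambda>g. [:1 - p, p:] * down (real n) g"
  have dim: "dim_row ?K = n + 1" "dim_col ?K = n + 1"
    by (simp_all add: bd_chain_def)
  have sq: "dim_row (?K ^\<^sub>m r) = n + 1" "dim_col (?K ^\<^sub>m r) = n + 1"
    using pow_mat_dim_square[of ?K "n + 1" r] dim by auto
  have row: "row_poly (?K ^\<^sub>m r) x = (\<Sum>z<n + 1. smult ((?K ^\<^sub>m r) $$ (x, z)) (monom 1 z))"
    unfolding row_poly_def sq by (simp add: smult_monom)
  have "smult (real n ^ Suc r) (row_poly (?K ^\<^sub>m Suc r) x)
      = smult (real n ^ r) (\<Sum>z<n + 1. smult ((?K ^\<^sub>m r) $$ (x, z)) (smult (real n) (row_poly ?K z)))"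
    using assms dim sq
    by (simp add: row_poly_mult smult_sum_right smult_add_right mult_ac)
  also have "\<dots> = smult (real n ^ r) (\<Sum>z<n + 1. smult ((?K ^\<^sub>m r) $$ (x, z)) (?T (monom 1 z)))"
    using assms(1) by (intro arg_cong[of _ _ "smult _"] sum.cong) (auto simp: row_poly_bd_chain)
  also have "\<dots> = ?T (smult (real n ^ r) (row_poly (?K ^\<^sub>m r) x))"
    unfolding row down_smult down_sum
    by (simp only: smult_sum_right sum_distrib_left mult_smult_right)
  finally show ?case by (simp add: Suc)
qed

lemma bd_chain_power_expansion:
  assumes "n \<ge> 1" "x \<le> n" "y \<le> n"
  shows "real n ^ r * (bd_chain n p ^\<^sub>m r) $$ (x, y)
    = (\<Sum>j\<le>r. real (Stirling r j) * coeff ([:1 - p, p:] ^ j * downs (real n) j (monom 1 x)) y)"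
proof -
  have "dim_col (bd_chain n p ^\<^sub>m r) = n + 1"
    using pow_mat_dim_square[of "bd_chain n p" "n + 1" r] by (simp add: bd_chain_def)
  then have "real n ^ r * (bd_chain n p ^\<^sub>m r) $$ (x, y)
      = coeff (smult (real n ^ r) (row_poly (bd_chain n p ^\<^sub>m r) x)) y"
    using assms by (simp add: coeff_row_poly)
  then show ?thesis
    unfolding row_poly_bd_chain_power[OF assms(1,2)] up_down_funpow by (simp add: coeff_sum)
qed

section \<open>The extremal ratio and the separation distance\<close>

lemma coeff_mult_nonneg:
  fixes f g :: "real poly"
  assumes "\<And>i. coeff f i \<ge> 0" "\<And>i. coeff g i \<ge> 0"
  shows "coeff (f * g) i \<ge> 0"
  unfolding coeff_mult using assms by (intro sum_nonneg mult_nonneg_nonneg) auto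

lemma coeff_power_nonneg:
  fixes f :: "real poly"
  assumes "\<And>i. coeff f i \<ge> 0"
  shows "coeff (f ^ n) i \<ge> 0"
proof (induction n arbitrary: i)
  case (Suc n)
  then show ?case using assms by (simp only: power_Suc) (intro coeff_mult_nonneg)
qed (simp add: one_pCons coeff_pCons split: nat.split)

lemma bd_chain_power_ge:
  assumes "n \<ge> 1" "0 < p" "p < 1" "x \<le> n" "y \<le> n"
  shows "fact n * real (Stirling r n) / real n ^ r * pmf (binomial_pmf n p) y
    \<le> (bd_chain n p ^\<^sub>m r) $$ (x, y)"
proof -
  let ?L = "[:1 - p, p:]"
  define t where "t j = real (Stirling r j) * coeff (?L ^ j * downs (real n) j (monom 1 x)) y" for j
  have t: "t j \<ge> 0" for j
  proof -
    have "coeff ?L i \<ge> 0" for i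
      using assms by (auto simp: coeff_pCons split: nat.split)
    moreover have "coeff (downs (real n) j (monom 1 x)) i \<ge> 0" for i
      using coeff_downs[of "monom 1 x" n j i] assms by (simp add: degree_monom_eq)
    ultimately show ?thesis
      unfolding t_def by (intro mult_nonneg_nonneg coeff_mult_nonneg coeff_power_nonneg) auto
  qed
  have "downs (real n) n (monom 1 x) = [:fact n:]"
    using assms by (subst downs_full) (auto simp: degree_monom_eq poly_monom)
  then have "t n = real (Stirling r n) * (fact n * pmf (binomial_pmf n p) y)"
    using assms by (simp add: t_def coeff_linear_poly_power)
  moreover have "t n \<le> (\<Sum>j\<le>r. t j)"
  proof (cases "n \<le> r")
    case True
    then show ?thesis using t by (intro member_le_sum) auto
  next
    \<comment> \<open>The sum has no index \<open>n\<close> here, but \<open>Stirling r n\<close> is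
      0 as well.\<close>
    case False
    then have "t n = 0" by (simp add: t_def)
    then show ?thesis using t by (simp add: sum_nonneg)
  qed
  ultimately show ?thesis
    using bd_chain_power_expansion[OF assms(1,4,5), of r p, folded t_def] assms(1)
    by (simp add: divide_simps mult_ac del: pmf_binomial)
qed

lemma bd_chain_power_corner:
  assumes "n \<ge> 1" "0 < p" "p < 1"
  shows "(bd_chain n p ^\<^sub>m r) $$ (0, n)
    = fact n * real (Stirling r n) / real n ^ r * pmf (binomial_pmf n p) n"
proof -
  let ?L = "[:1 - p, p:]"
  \<comment> \<open>State 0 is the constant polynomial 1; on constants \<open>down\<close> only
    multiplies.\<close>
  have deg: "downs (real n) j 1 = [:\<Prod>i<j. real n - real i:]" for j
    by (induction j) (simp_all add: one_pCons down_def mult_ac)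
  have "coeff (?L ^ j * downs (real n) j 1) n = (if j = n then fact n * p ^ n else 0)" for j
  proof -
    consider "j < n" | "j = n" | "j > n" by linarith
    then show ?thesis
    proof cases
      case 1
      have "degree (?L ^ j) \<le> j"
        using degree_power_le[of ?L j] by (simp split: if_splits)
      then show ?thesis using 1 by (simp add: deg coeff_eq_0)
    next
      case 2
      then show ?thesis
        using downs_full[of 1 n] by (simp add: coeff_linear_poly_power)
    next
      case 3
      then have "(\<Prod>i<j. real n - real i) = 0" by (intro prod_zero) auto
      then show ?thesis using 3 by (simp add: deg)
    qed
  qed
  then have "(\<Sum>j\<le>r. real (Stirling r j) * coeff (?L ^ j * downs (real n) j (monom 1 0)) n)
      = (\<Sum>j\<le>r. if j = n then real (Stirling r n) * (fact n * p ^ n) else 0)"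
    by (intro sum.cong refl) (simp add: monom_0 flip: one_pCons)
  also have "\<dots> = real (Stirling r n) * (fact n * p ^ n)"
    by simp
  finally have "real n ^ r * (bd_chain n p ^\<^sub>m r) $$ (0, n) = real (Stirling r n) * (fact n * p ^ n)"
    using assms by (simp only: bd_chain_power_expansion)
  then show ?thesis using assms by (simp add: field_simps)
qed

lemma sep_bd_eq_Stirling:
  assumes "n \<ge> 1" "0 < p" "p < 1"
  shows "sep_bd n p r = 1 - fact n * real (Stirling r n) / real n ^ r"
proof -
  have dim: "dim_row (bd_chain n p) = n + 1" by (simp add: bd_chain_def)
  show ?thesis
    unfolding sep_bd_def max_separation_def dim
  proof (rule Max_eqI)
    fix s assume "s \<in> (\<lambda>(x, y). 1 - (bd_chain n p ^\<^sub>m r) $$ (x, y) / pmf (binomial_pmf n p) y)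
      ` ({..<n + 1} \<times> {..<n + 1})"
    then obtain x y where *: "x \<le> n" "y \<le> n"
      and s: "s = 1 - (bd_chain n p ^\<^sub>m r) $$ (x, y) / pmf (binomial_pmf n p) y"
      by (auto simp: less_Suc_eq_le)
    have "pmf (binomial_pmf n p) y > 0" using assms * by simp
    then show "s \<le> 1 - fact n * real (Stirling r n) / real n ^ r"
      using bd_chain_power_ge[OF assms *, of r] unfolding s by (simp only: pos_le_divide_eq diff_left_mono)
  next
    have "pmf (binomial_pmf n p) n > 0" using assms by simp
    then show "1 - fact n * real (Stirling r n) / real n ^ r
      \<in> (\<lambda>(x, y). 1 - (bd_chain n p ^\<^sub>m r) $$ (x, y) / pmf (binomial_pmf n p) y)
      ` ({..<n + 1} \<times> {..<n + 1})"
      using bd_chain_power_corner[OF assms, of r]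
      by (intro image_eqI[where x = "(0, n)"]) auto
  qed simp
qed

section \<open>Sums of geometric variables\<close>

text \<open>Order blocks by least element: the first \<open>i\<close> elements fill \<open>k\<close>
  blocks, the next opens the last block, and each later one has \<open>k + 1\<close>
  choices.\<close>

lemma Stirling_Suc_conv_sum:
  "Stirling r (Suc k) = (\<Sum>i<r. Suc k ^ (r - Suc i) * Stirling i k)"
proof (induction r)
  case (Suc r)
  have "(\<Sum>i<r. Suc k ^ (Suc r - Suc i) * Stirling i k)
      = Suc k * (\<Sum>i<r. Suc k ^ (r - Suc i) * Stirling i k)"
    unfolding sum_distrib_left by (intro sum.cong) (auto simp: Suc_diff_le Suc_diff_Suc[symmetric] algebra_simps)
  then show ?case by (simp add: Suc)
qed simp

lemma pmf_add_convolution: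
  fixes M N :: "nat pmf"
  shows "pmf (map_pmf (\<lambda>(x, y). x + y) (pair_pmf M N)) m = (\<Sum>i\<le>m. pmf M (m - i) * pmf N i)"
proof -
  have "(\<lambda>(x, y). x + y) -` {m} = (\<lambda>i. (m - i, i)) ` {..m}"
    by (auto simp: image_iff)
  moreover have "inj_on (\<lambda>i. (m - i, i)) {..m}" by (auto intro: inj_onI)
  ultimately show ?thesis
    by (simp add: pmf_map measure_measure_pmf_finite sum.reindex pmf_pair)
qed

text \<open>
  The parameters \<open>n / n, (n - 1) / n, \<dots>, (n - k) / n\<close> are those of the waiting times for the first
  \<open>k + 1\<close> distinct coupons.
\<close>

lemma pmf_coupon_stage:
  fixes n k :: nat
  defines "S \<equiv> \<lambda>k. map_pmf (\<lambda>f. \<Sum>i\<in>{n - k..n}. f i)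
    (Pi_pmf {n - k..n} 0 (\<lambda>i. geometric1_pmf (real i / real n)))"
  assumes "k < n"
  shows "pmf (S k) 0 = 0 \<and> (\<forall>m. pmf (S k) (Suc m)
    = (\<Prod>i\<le>k. real n - real i) * real (Stirling m k) / real n ^ Suc m)"
  using assms(2)
proof (induction k)
  case 0
  \<comment> \<open>The first coupon is always new: its parameter is \<open>n / n\<close>.\<close>
  have "S 0 = geometric1_pmf 1"
    unfolding S_def using 0 by (simp add: Pi_pmf_singleton pmf.map_comp o_def)
  moreover have "pmf (geometric1_pmf 1) 0 = 0"
    by (simp add: geometric1_pmf_def)
  moreover have "real (Stirling m 0) = 0 ^ m" for m
    by (cases m) simp_all
  ultimately show ?case
    using 0 by (auto simp: pmf_geometric1 power_0_left)
next
  case (Suc k)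
  let ?g = "\<lambda>i. geometric1_pmf (real i / real n)"
  let ?a = "n - Suc k"
  have ins: "{?a..n} = insert ?a {n - k..n}" using Suc.prems by auto
  have S: "S (Suc k) = map_pmf (\<lambda>(x, y). x + y) (pair_pmf (?g ?a) (S k))"
    unfolding S_def ins using Suc.prems
    by (subst Pi_pmf_insert) (auto simp: pmf.map_comp o_def pair_map_pmf2 case_prod_unfold
        intro!: map_pmf_cong arg_cong2[of _ _ _ _ plus] sum.cong)
  have q: "real ?a / real n = (real n - real (Suc k)) / real n" "1 - real ?a / real n = real (Suc k) / real n"
    using Suc.prems by (auto simp: field_simps)
  have q01: "0 < real ?a / real n" "real ?a / real n \<le> 1" using Suc.prems by auto
  have g0: "pmf (?g ?a) 0 = 0"
    by (simp add: geometric1_pmf_def pmf_eq_0_set_pmf)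
  have S0: "pmf (S k) 0 = 0"
    using Suc by simp
  have "pmf (S (Suc k)) 0 = 0"
    unfolding S pmf_add_convolution by (simp add: g0)
  moreover have "pmf (S (Suc k)) (Suc m) =
      (\<Prod>i\<le>Suc k. real n - real i) * real (Stirling m (Suc k)) / real n ^ Suc m" for m
  proof -
    have "pmf (S (Suc k)) (Suc m) = (\<Sum>i\<le>Suc m. pmf (?g ?a) (Suc m - i) * pmf (S k) i)"
      unfolding S pmf_add_convolution ..
    \<comment> \<open>Both summands are at least 1, so the two extreme terms of the convolution drop
      out.\<close>
    also have "\<dots> = (\<Sum>i<m. pmf (?g ?a) (m - i) * pmf (S k) (Suc i))"
      using S0 g0 by (subst sum.atMost_Suc_shift) (simp flip: lessThan_Suc_atMost)
    also have "\<dots> = (\<Sum>i<m. (real n - real (Suc k)) / real n * (real (Suc k) / real n) ^ (m - Suc i) *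
        ((\<Prod>i\<le>k. real n - real i) * real (Stirling i k) / real n ^ Suc i))"
      using Suc q q01 by (intro sum.cong) (simp_all add: pmf_geometric1)
    also have "\<dots> = (\<Sum>i<m. (\<Prod>i\<le>Suc k. real n - real i) / real n ^ Suc m
        * real (Suc k ^ (m - Suc i) * Stirling i k))"
    proof (intro sum.cong refl)
      fix i assume "i \<in> {..<m}"
      then have "real n ^ Suc m = real n ^ (m - Suc i) * real n ^ Suc i * real n"
        by (simp flip: power_add power_Suc power_Suc2)
      then show "(real n - real (Suc k)) / real n * (real (Suc k) / real n) ^ (m - Suc i) *
        ((\<Prod>i\<le>k. real n - real i) * real (Stirling i k) / real n ^ Suc i) =
        (\<Prod>i\<le>Suc k. real n - real i) / real n ^ Suc m * real (Suc k ^ (m - Suc i) * Stirling i k)"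
        using Suc.prems by (simp only: prod.atMost_Suc power_divide of_nat_mult of_nat_power) (simp add: field_simps)
    qed
    also have "\<dots> = (\<Prod>i\<le>Suc k. real n - real i) * real (Stirling m (Suc k)) / real n ^ Suc m"
      unfolding Stirling_Suc_conv_sum[of m] of_nat_sum sum_distrib_left[symmetric] by simp
    finally show ?thesis .
  qed
  ultimately show ?case by blast
qed

lemma prob_geometric_sum_gt:
  assumes "n \<ge> 1"
  shows "measure_pmf.prob (geometric_sum_pmf n) {m. m > r} = 1 - fact n * real (Stirling r n) / real n ^ r"
proof -
  obtain k where k: "n = Suc k" using assms by (cases n) auto
  have iv: "{n - k..n} = {1..n}" by (simp add: k)
  have pr: "(\<Prod>i\<le>k. real n - real i) = fact n"
    by (simp add: k fact_prod_rev of_nat_prod of_nat_diff atLeast0LessThan lessThan_Suc_atMost del: prod.op_ivl_Suc fact_Suc)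
  have pS: "pmf (geometric_sum_pmf n) (Suc m) = fact n * real (Stirling m k) / real n ^ Suc m" for m
    using pmf_coupon_stage[of k n] unfolding iv pr geometric_sum_pmf_def by (simp add: k)
  have p0: "pmf (geometric_sum_pmf n) 0 = 0"
    using pmf_coupon_stage[of k n] unfolding iv geometric_sum_pmf_def by (simp add: k)
  have "measure_pmf.prob (geometric_sum_pmf n) {..r} = (\<Sum>i\<le>r. pmf (geometric_sum_pmf n) i)"
    by (simp add: measure_measure_pmf_finite)
  also have "\<dots> = (\<Sum>i<r. pmf (geometric_sum_pmf n) (Suc i))"
    using p0 by (simp add: sum.lessThan_Suc_shift del: sum.lessThan_Suc flip: lessThan_Suc_atMost)
  \<comment> \<open>Over the common denominator \<open>n ^ r\<close>, this is the sum in
    \<open>Stirling_Suc_conv_sum\<close>, as \<open>n = k + 1\<close>.\<close>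
  also have "\<dots> = (\<Sum>i<r. fact n / real n ^ r * real (n ^ (r - Suc i) * Stirling i k))"
  proof (intro sum.cong refl)
    fix i assume "i \<in> {..<r}"
    then have "real n ^ r = real n ^ (r - Suc i) * real n ^ Suc i"
      by (simp flip: power_add del: power_Suc)
    then show "pmf (geometric_sum_pmf n) (Suc i) = fact n / real n ^ r * real (n ^ (r - Suc i) * Stirling i k)"
      using assms unfolding pS by (simp del: power_Suc)
  qed
  also have "\<dots> = fact n * real (Stirling r n) / real n ^ r"
    unfolding k Stirling_Suc_conv_sum[of r] of_nat_sum sum_distrib_left[symmetric] by simp
  finally have *: "measure_pmf.prob (geometric_sum_pmf n) {..r} = \<dots>" .
  have "{m. m > r} = UNIV - {..r}" by auto
  then show ?thesis
    using measure_pmf.prob_compl[of "{..r}" "geometric_sum_pmf n"] * by simp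
qed

section \<open>Asymptotics of the coupon collector\<close>

lemma real_binomial_absorb_comp:
  "(real n - real k) * real (n choose k) = real n * real (n - 1 choose k)"
proof (cases "k \<le> n")
  case True
  have "real (n - k) * real (n choose k) = real n * real (n - 1 choose k)"
    using binomial_absorb_comp[of n k] by (simp only: flip: of_nat_mult)
  then show ?thesis using True by (simp add: of_nat_diff)
qed (simp add: binomial_eq_0)

text \<open>Both sides count surjections, the right one by inclusion-exclusion. In the induction,
  one factor \<open>n - k\<close> is absorbed into the binomial and Pascal's rule splits off the
  case \<open>n - 1\<close>.\<close>

lemma fact_mult_Stirling:
  "fact n * real (Stirling r n) = (\<Sum>k\<le>n. (-1) ^ k * real (n choose k) * (real n - real k) ^ r)"
proof (induction r arbitrary: n)
  case 0
  show ?case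
    using choose_alternating_sum[of n, where 'a = real] by (cases n) auto
next
  case (Suc r)
  show ?case
  proof (cases n)
    case 0
    then show ?thesis by simp
  next
    case (Suc m)
    let ?d = "\<lambda>k. if k = 0 then 0 else real (m choose (k - 1))"
    have absorb: "(real n - real k) * real (n choose k) = real n * (real (n choose k) - ?d k)"
      if "k \<le> n" for k
    proof -
      have "(real n - real k) * real (n choose k) = real n * real (m choose k)"
        using real_binomial_absorb_comp[of n k] by (simp add: Suc)
      moreover have "real (n choose k) = real (m choose k) + ?d k"
        by (cases k) (simp_all add: Suc)
      ultimately show ?thesis by simp
    qed
    have "(\<Sum>k\<le>n. (-1) ^ k * real (n choose k) * (real n - real k) ^ Suc r)
        = (\<Sum>k\<le>n. (-1) ^ k * ((real n - real k) * real (n choose k)) * (real n - real k) ^ r)"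
      by (simp add: mult_ac)
    also have "\<dots> = (\<Sum>k\<le>n. real n * ((-1) ^ k * real (n choose k) * (real n - real k) ^ r)
          - real n * ((-1) ^ k * ?d k * (real n - real k) ^ r))"
      by (intro sum.cong refl) (simp add: absorb, simp add: algebra_simps)
    also have "\<dots> = real n * (\<Sum>k\<le>n. (-1) ^ k * real (n choose k) * (real n - real k) ^ r)
          - real n * (\<Sum>k\<le>n. (-1) ^ k * ?d k * (real n - real k) ^ r)"
      by (simp add: sum_subtractf sum_distrib_left)
    also have "(\<Sum>k\<le>n. (-1) ^ k * ?d k * (real n - real k) ^ r)
          = - (\<Sum>k\<le>m. (-1) ^ k * real (m choose k) * (real m - real k) ^ r)"
      unfolding Suc by (subst sum.atMost_Suc_shift) (simp add: sum_negf)
    finally show ?thesis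
      unfolding Suc.IH[symmetric] by (simp add: Suc algebra_simps)
  qed
qed

section \<open>Exponential and falling factorial estimates\<close>

text \<open>From \<open>(1 - u) * exp u \<ge> (1 - u) * (1 + u)\<close> and Bernoulli's
  inequality.\<close>

lemma power_one_minus_ge:
  fixes u :: real
  assumes "0 \<le> u" "u \<le> 1"
  shows "(1 - u) ^ r \<ge> exp (- (real r * u)) * (1 - real r * u\<^sup>2)"
proof -
  have "1 - real r * u\<^sup>2 \<le> (1 - u\<^sup>2) ^ r"
    using Bernoulli_inequality[of "- u\<^sup>2" r] assms by (simp add: abs_square_le_1)
  also have "(1 - u\<^sup>2) ^ r \<le> ((1 - u) * exp u) ^ r"
  proof (rule power_mono)
    have "(1 - u) * (1 + u) \<le> (1 - u) * exp u"
      using assms by (intro mult_left_mono exp_ge_add_one_self) auto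
    then show "1 - u\<^sup>2 \<le> (1 - u) * exp u" by (simp add: power2_eq_square algebra_simps)
  qed (use assms in \<open>simp add: abs_square_le_1\<close>)
  also have "\<dots> = (1 - u) ^ r * exp (real r * u)"
    by (simp add: power_mult_distrib exp_of_nat_mult)
  finally show ?thesis
    by (simp add: exp_minus field_simps)
qed

lemma power_one_minus_le:
  fixes u :: real
  assumes "u \<le> 1"
  shows "(1 - u) ^ r \<le> exp (- (real r * u))"
proof -
  have "(1 - u) ^ r \<le> exp (- u) ^ r"
    using assms exp_ge_add_one_self[of "-u"] by (intro power_mono) auto
  then show ?thesis by (simp add: exp_of_nat_mult[symmetric])
qed

text \<open>The ratio is the product of \<open>1 - i / n\<close> over \<open>i < k\<close>.\<close>

lemma binomial_fact_ratio_bounds: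
  fixes n k :: nat
  assumes "n \<ge> 1"
  defines "a \<equiv> \<lambda>k. real (n choose k) * fact k / real n ^ k"
  shows "1 - real k ^ 2 / real n \<le> a k" "a k \<le> 1"
proof -
  have step: "a (Suc k) = (1 - real k / real n) * a k" for k
  proof -
    have "real (Suc k) * real (n choose Suc k) = (real n - real k) * real (n choose k)"
      unfolding real_binomial_absorb_comp
      using binomial_absorption[of k n] by (simp only: flip: of_nat_mult)
    then have "a (Suc k) = (real n - real k) * real (n choose k) * fact k / real n ^ Suc k"
      unfolding a_def fact_Suc by (metis mult.assoc mult.commute)
    also have "\<dots> = (1 - real k / real n) * a k"
      using assms(1) unfolding a_def by (simp add: field_simps)
    finally show ?thesis .
  qed
  have a0: "a k \<ge> 0" for k by (simp add: a_def)
  have le1: "a k \<le> 1" for k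
  proof (induction k)
    case (Suc k)
    have "(1 - real k / real n) * a k \<le> 1 * a k" using a0 by (intro mult_right_mono) auto
    then show ?case using Suc unfolding step by linarith
  qed (simp add: a_def)
  then show "a k \<le> 1" .
  show "1 - real k ^ 2 / real n \<le> a k"
  proof (induction k)
    case (Suc k)
    have "real k / real n * a k \<le> real k / real n * 1"
      using le1 by (intro mult_left_mono) auto
    moreover have "real k / real n + real k ^ 2 / real n \<le> real (Suc k) ^ 2 / real n"
      by (simp add: power2_eq_square field_simps flip: add_divide_distrib) (simp add: divide_right_mono)
    ultimately show ?case using Suc unfolding step by (simp add: algebra_simps)
  qed (simp add: a_def)
qed

text \<open>
  The inclusion-exclusion terms are compared with those of the series of \<open>exp (- exp (- c))\<close>, with a
  relative error of order \<open>k\<^sup>2 ln n / n\<close>. For \<open>k > n\<close> the binomial coefficient vanishes, but then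
  \<open>k\<^sup>2 / n \<ge> 1\<close>, so the bound holds there as well.
\<close>

lemma coupon_term_bound:
  fixes n r k :: nat and c :: real
  assumes n: "n \<ge> 1" and r: "real r \<le> real n * ln (real n) + c * real n"
    "real n * ln (real n) + c * real n < real r + 1"
  defines "w \<equiv> exp (- c) ^ k / fact k"
  shows "\<bar>real (n choose k) * (1 - real k / real n) ^ r - w\<bar>
    \<le> w * (real k ^ 2 * (3 + real r / real n) / real n)"
proof (cases "k \<le> n")
  case False
  then have "real n * 1 \<le> real k * real k" using n by (intro mult_mono) auto
  then have "1 \<le> real k ^ 2 / real n" using n by (simp add: power2_eq_square)
  then have "1 * 1 \<le> real k ^ 2 / real n * (3 + real r / real n)"
    using n by (intro mult_mono) auto
  moreover have "w \<ge> 0" by (simp add: w_def)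
  ultimately have "w * 1 \<le> w * (real k ^ 2 * (3 + real r / real n) / real n)"
    by (intro mult_left_mono) auto
  then show ?thesis using False \<open>w \<ge> 0\<close> by (simp add: binomial_eq_0)
next
  case True
  define u where "u = real k / real n"
  define a where "a = real (n choose k) * fact k / real n ^ k"
  define E where "E = exp (real k * (ln (real n) + c))"
  define b where "b = (1 - u) ^ r * E"
  define s where "s = real k ^ 2 / real n"
  have u: "0 \<le> u" "u \<le> 1" using True n by (auto simp: u_def)
  have s: "u \<le> s" "s \<ge> 0" "real r * u\<^sup>2 = real r / real n * s"
    using n self_le_power[of "real k" 2]
    by (cases "k = 0"; auto simp: u_def s_def power2_eq_square divide_right_mono)+
  have Eeq: "E = real n ^ k * exp c ^ k"
    using n by (simp add: E_def distrib_left exp_add exp_of_nat_mult)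
  \<comment> \<open>It remains to show that \<open>a\<close> and \<open>b\<close> are both close to
    1.\<close>
  have t: "real (n choose k) * (1 - real k / real n) ^ r = w * (a * b)"
    using n unfolding w_def a_def b_def Eeq u_def
    by (simp add: exp_minus field_simps)
  \<comment> \<open>The error in the exponent caused by rounding to the integer \<open>r\<close>;
    rounding by less than 1 costs at most \<open>u\<close>.\<close>
  define h where "h = real k * (ln (real n) + c) - real r * u"
  have "h = u * (real n * ln (real n) + c * real n - real r)"
    using n by (simp add: h_def u_def field_simps)
  moreover have "u * (real n * ln (real n) + c * real n - real r) \<le> u * 1"
    using r u by (intro mult_left_mono) auto
  ultimately have h: "0 \<le> h" "h \<le> u"
    using r u by auto
  have b0: "b \<ge> 0" using u by (simp add: b_def E_def)
  have "b \<le> exp (- (real r * u)) * E"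
    unfolding b_def E_def using u by (intro mult_right_mono power_one_minus_le) auto
  also have "\<dots> = exp h" by (simp add: E_def h_def exp_diff exp_minus field_simps)
  also have "\<dots> \<le> exp u" using h by simp
  also have "\<dots> \<le> 1 + u + u\<^sup>2" using u by (intro exp_bound) auto
  also have "\<dots> \<le> 1 + 2 * u" using u by (simp add: power2_eq_square mult_left_le)
  finally have b_le: "b \<le> 1 + 2 * s" using s by simp
  have b_ge: "b \<ge> 1 - real r / real n * s"
  proof (cases "real r * u\<^sup>2 \<le> 1")
    case True
    have "1 * (1 - real r * u\<^sup>2) \<le> exp h * (1 - real r * u\<^sup>2)"
      using True h by (intro mult_right_mono) auto
    also have "\<dots> = exp (- (real r * u)) * (1 - real r * u\<^sup>2) * E"
      by (simp add: E_def h_def exp_diff exp_minus field_simps)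
    also have "\<dots> \<le> b"
      unfolding b_def E_def using u by (intro mult_right_mono power_one_minus_ge) auto
    finally show ?thesis using s by simp
  next
    case False
    then show ?thesis using b0 s by simp
  qed
  have a: "1 - s \<le> a" "a \<le> 1"
    using binomial_fact_ratio_bounds[OF n, of k] by (simp_all add: a_def s_def)
  have a0: "a \<ge> 0" by (simp add: a_def)
  have rs: "real r / real n * s \<ge> 0" using s by simp
  have "a * b \<le> 1 * b" using a b0 by (intro mult_right_mono) auto
  \<comment> \<open>Passing from \<open>b\<close> to \<open>a * b\<close> loses at most
    \<open>s\<close> if \<open>b \<le> 1\<close>; otherwise \<open>a * b \<ge> a\<close>
    suffices.\<close>
  moreover have "1 - s - real r / real n * s \<le> a * b"
  proof (cases "b \<le> 1")
    case True
    have "(1 - a) * b \<le> (1 - a) * 1" using a True by (intro mult_left_mono) auto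
    then show ?thesis using a b_ge by (simp add: algebra_simps)
  next
    case False
    have "a * 1 \<le> a * b" using a0 False by (intro mult_left_mono) auto
    then show ?thesis using a rs by linarith
  qed
  \<comment> \<open>The excess is at most \<open>2 * s\<close>, the deficit at most
    \<open>s * (1 + r / n)\<close>; the constant 3 covers both.\<close>
  ultimately have "\<bar>a * b - 1\<bar> \<le> s * (3 + real r / real n)"
    using b_le s(2) rs unfolding abs_le_iff mult.commute[of s] distrib_right
    by (intro conjI) linarith+
  then have "w * \<bar>a * b - 1\<bar> \<le> w * (s * (3 + real r / real n))"
    by (intro mult_left_mono) (auto simp: w_def)
  moreover have "w * (a * b) - w = w * (a * b - 1)" "w \<ge> 0"
    by (simp add: algebra_simps) (simp add: w_def)
  ultimately show ?thesis unfolding t s_def by (simp add: abs_mult)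
qed

text \<open>Bounding \<open>k\<^sup>2\<close> by \<open>4 ^ k\<close> makes the termwise errors sum
  to an exponential series at \<open>4 * exp (- c)\<close>.\<close>

lemma coupon_collector_estimate:
  fixes n r :: nat and c :: real
  assumes n: "n \<ge> 1" and r: "real r \<le> real n * ln (real n) + c * real n"
    "real n * ln (real n) + c * real n < real r + 1"
  shows "\<bar>fact n * real (Stirling r n) / real n ^ r - exp (- exp (- c))\<bar>
    \<le> exp (4 * exp (- c)) * ((3 + real r / real n) / real n)"
proof -
  let ?x = "exp (- c)" and ?C = "(3 + real r / real n) / real n"
  let ?t = "\<lambda>k. real (n choose k) * (1 - real k / real n) ^ r"
  have "fact n * real (Stirling r n) / real n ^ r = (\<Sum>k\<le>n. (-1) ^ k * ?t k)"
    unfolding fact_mult_Stirling sum_divide_distrib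
  proof (intro sum.cong refl)
    fix k
    have "1 - real k / real n = (real n - real k) / real n" using n by (simp add: field_simps)
    then show "(- 1) ^ k * real (n choose k) * (real n - real k) ^ r / real n ^ r = (-1) ^ k * ?t k"
      by (simp add: power_divide)
  qed
  \<comment> \<open>The binomial vanishes for \<open>k > n\<close>, so the finite sum is also a
    series.\<close>
  moreover have "(\<lambda>k. (-1) ^ k * ?t k) sums (\<Sum>k\<le>n. (-1) ^ k * ?t k)"
    by (intro sums_finite) auto
  moreover have "(\<lambda>k. (-1) ^ k * (?x ^ k / fact k)) sums exp (- ?x)"
    using exp_converges[of "- ?x"] by (simp add: power_minus[of ?x] field_simps)
  ultimately have "(\<lambda>k. (-1) ^ k * ?t k - (-1) ^ k * (?x ^ k / fact k))
      sums (fact n * real (Stirling r n) / real n ^ r - exp (- ?x))"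
    by (intro sums_diff) simp_all
  then have S: "(\<lambda>k. (-1) ^ k * (?t k - ?x ^ k / fact k))
      sums (fact n * real (Stirling r n) / real n ^ r - exp (- ?x))"
    by (simp only: right_diff_distrib)
  have T: "(\<lambda>k. (4 * ?x) ^ k / fact k * ?C) sums (exp (4 * ?x) * ?C)"
    using exp_converges[of "4 * ?x"] by (intro sums_mult2) (simp add: field_simps)
  have "norm ((-1) ^ k * (?t k - ?x ^ k / fact k)) \<le> (4 * ?x) ^ k / fact k * ?C" for k
  proof -
    have "real k ^ 2 \<le> (2 ^ k) ^ 2"
      by (intro power_mono) (auto intro: less_imp_le of_nat_less_two_power)
    also have "\<dots> = (4::real) ^ k" by (simp add: power2_eq_square flip: power_mult_distrib)
    finally have k2: "real k ^ 2 \<le> 4 ^ k" .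
    have "norm ((-1) ^ k * (?t k - ?x ^ k / fact k)) \<le> ?x ^ k / fact k * (real k ^ 2 * ?C)"
      using coupon_term_bound[OF n r, of k] by (simp add: abs_mult power_abs)
    also have "\<dots> \<le> ?x ^ k / fact k * (4 ^ k * ?C)"
      using k2 by (intro mult_left_mono mult_right_mono) auto
    also have "\<dots> = (4 * ?x) ^ k / fact k * ?C" by (simp add: power_mult_distrib)
    finally show ?thesis .
  qed
  then have "norm (\<Sum>k. (-1) ^ k * (?t k - ?x ^ k / fact k)) \<le> (\<Sum>k. (4 * ?x) ^ k / fact k * ?C)"
    using T by (intro norm_suminf_le) (auto simp: sums_iff)
  then show ?thesis
    using S T by (simp add: sums_iff)
qed

text \<open>\<open>n \<ge> 3\<close> gives \<open>ln n \<ge> 1\<close>, which absorbs the constants;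
  \<open>n \<ge> exp (- c)\<close> makes the argument of \<open>nat\<close> nonnegative, so nothing
  is truncated.\<close>

lemma coupon_collector_asymptotics:
  fixes c :: real and n :: nat
  assumes "n \<ge> 3" "real n \<ge> exp (- c)"
  defines "r \<equiv> nat \<lfloor>real n * ln (real n) + c * real n\<rfloor>"
  shows "\<bar>fact n * real (Stirling r n) / real n ^ r - exp (- exp (- c))\<bar>
    \<le> exp (4 * exp (- c)) * (4 + \<bar>c\<bar>) * (ln (real n) / real n)"
proof -
  have ln1: "ln (real n) \<ge> 1"
    using assms(1) exp_le by (simp add: ln_ge_iff)
  have "ln (real n) + c \<ge> 0"
    using assms(1,2) ln_ge_iff[of "real n" "- c"] by simp
  then have "real n * ln (real n) + c * real n \<ge> 0"
    using mult_nonneg_nonneg[of "real n" "ln (real n) + c"] by (simp add: algebra_simps)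
  then have r: "real r \<le> real n * ln (real n) + c * real n"
      "real n * ln (real n) + c * real n < real r + 1"
    unfolding r_def by linarith+
  have "real r / real n \<le> ln (real n) + c"
    using r(1) assms(1) by (simp add: field_simps)
  moreover have "\<bar>c\<bar> * 1 \<le> \<bar>c\<bar> * ln (real n)" using ln1 by (intro mult_left_mono) auto
  ultimately have "3 + real r / real n \<le> (4 + \<bar>c\<bar>) * ln (real n)"
    using ln1 by (simp add: algebra_simps)
  then have "exp (4 * exp (- c)) * ((3 + real r / real n) / real n)
      \<le> exp (4 * exp (- c)) * ((4 + \<bar>c\<bar>) * ln (real n) / real n)"
    by (intro mult_left_mono divide_right_mono) auto
  then show ?thesis
    using coupon_collector_estimate[OF _ r] assms(1) by simp
qed

theorem proposition8p8:
  shows "(\<forall>(n::nat) (p::real) (r::nat). n \<ge> 1 \<longrightarrow> 0 < p \<longrightarrow> p < 1 \<longrightarrow>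
            sep_bd n p r = measure_pmf.prob (geometric_sum_pmf n) {m. m > r} \<and>
            sep_bd n p r = 1 - fact n * real (Stirling r n) / real n ^ r) \<and>
         (\<forall>c::real.
            (\<lambda>(n, p). sep_bd n p (nat \<lfloor>real n * ln (real n) + c * real n\<rfloor>)
                - (1 - exp (- exp (- c))))
              \<in> O[sequentially \<times>\<^sub>F principal {0<..<1}](\<lambda>(n, p). ln (real n) / real n))"
proof (intro conjI allI impI)
  fix c :: real
  have "eventually (\<lambda>n. n \<ge> 3 \<and> real n \<ge> exp (- c)) sequentially"
    by (intro eventually_conj eventually_ge_at_top
        eventually_compose_filterlim[OF eventually_ge_at_top filterlim_real_sequentially])
  moreover have "eventually (\<lambda>p::real. p \<in> {0<..<1}) (principal {0<..<1})"
    by (simp add: eventually_principal)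
  ultimately have "eventually (\<lambda>(n, p). (n \<ge> 3 \<and> real n \<ge> exp (- c)) \<and> p \<in> {0<..<1::real})
      (sequentially \<times>\<^sub>F principal {0<..<1})"
    unfolding eventually_prod_filter by fast
  then show "(\<lambda>(n, p). sep_bd n p (nat \<lfloor>real n * ln (real n) + c * real n\<rfloor>)
                - (1 - exp (- exp (- c))))
              \<in> O[sequentially \<times>\<^sub>F principal {0<..<1}](\<lambda>(n, p). ln (real n) / real n)"
  \<comment> \<open>The constant is uniform in \<open>p\<close> because the Stirling formula for
    \<open>sep_bd\<close> is free of \<open>p\<close>.\<close>
  proof (intro bigoI[where c = "exp (4 * exp (- c)) * (4 + \<bar>c\<bar>)"], elim eventually_mono, safe)
    fix n :: nat and p :: real
    assume n: "n \<ge> 3" "real n \<ge> exp (- c)" and p: "p \<in> {0<..<1}"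
    then show "norm (sep_bd n p (nat \<lfloor>real n * ln (real n) + c * real n\<rfloor>) - (1 - exp (- exp (- c))))
        \<le> exp (4 * exp (- c)) * (4 + \<bar>c\<bar>) * norm (ln (real n) / real n)"
      using coupon_collector_asymptotics[OF n] by (simp add: sep_bd_eq_Stirling abs_minus_commute)
  qed
qed (simp_all add: sep_bd_eq_Stirling prob_geometric_sum_gt)

end
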